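(* Let $\Sigma$ be a finite alphabet with $|\Sigma| \geq 2$ and $\mathbb{D}$ a value domain. For every property $\varPhi : \Sigma^\omega \to \mathbb{D}$, there exist two live properties $\varPsi_1, \varPsi_2 : \Sigma^\omega \to \mathbb{D}$ such that $\varPhi(w) = \min(\varPsi_1(w), \varPsi_2(w))$ for all $w \in \Sigma^\omega$.
   Context: $\Sigma^*$ and $\Sigma^\omega$ are the sets of finite and infinite words over $\Sigma$; $u \prec w$ means that the finite word $u$ is a strict prefix of $w$ (the empty word is allowed). A value domain $\mathbb{D}$ is a complete lattice with $\bot \neq \top$; $\min$ denotes the binary greatest lower bound (meet). A property is a total function $\Sigma^\omega \to \mathbb{D}$. A property $\varPsi$ is live in a domain $\mathbb{D}'$ when for all $w \in \Sigma^\omega$, if $\varPsi(w) < \sup \mathbb{D}'$, then there exists a value $v \in \mathbb{D}'$ such that $\varPsi(w) \not\geq v$ and for all prefixes $u \prec w$ we have $\sup_{w' \in \Sigma^\omega} \varPsi(uw') \geq v$. Convention: "$\varPsi$ is live" (with no domain mentioned) means that $\varPsi$ is live in $\mathbb{D}_\varPsi = \{v \in \mathbb{D} : v \leq \sup_{w \in \Sigma^\omega} \varPsi(w)\}$. *)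

theory Defs
  imports "HOL-Library.Omega_Words_Fun" "HOL-Library.Cardinality"
begin

text \<open>
  The alphabet is a type \<open>'a\<close>, so finite words are \<open>'a list\<close> and infinite words are \<open>'a word\<close>.
  A value domain is a type \<open>'d\<close> of class \<open>complete_lattice\<close>; that class admits the one-element
  lattice, so \<open>bot \<noteq> top\<close> has to be assumed separately.
\<close>

type_synonym ('a, 'd) property = "'a word \<Rightarrow> 'd"

definition word_prefix :: "'a list \<Rightarrow> 'a word \<Rightarrow> bool" (infix \<open>\<prec>\<close> 50)
  where "u \<prec> w \<longleftrightarrow> (\<exists>w'. w = u \<frown> w')"

text \<open>
  A sub-domain is a set of values, and \<open>Sup D\<close> is its supremum in the ambient lattice.
  For \<open>D = {v. v \<le> s}\<close>, as in \<open>domain_of\<close> below, this agrees with the supremum computed in \<open>D\<close>.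
\<close>

definition live_in :: "'d::complete_lattice set \<Rightarrow> ('a, 'd) property \<Rightarrow> bool"
  where "live_in D \<Psi> \<longleftrightarrow>
    (\<forall>w. \<Psi> w < Sup D \<longrightarrow>
      (\<exists>v\<in>D. \<not> \<Psi> w \<ge> v \<and> (\<forall>u. u \<prec> w \<longrightarrow> (SUP w'. \<Psi> (u \<frown> w')) \<ge> v)))"

definition domain_of :: "('a, 'd::complete_lattice) property \<Rightarrow> 'd set"
  where "domain_of \<Psi> = {v. v \<le> (SUP w. \<Psi> w)}"

definition live :: "('a, 'd::complete_lattice) property \<Rightarrow> bool"
  where "live \<Psi> \<longleftrightarrow> live_in (domain_of \<Psi>) \<Psi>"

end

theory Submission
  imports Defs
begin

text \<open>
  For letters \<open>a \<noteq> b\<close>, the words that are eventually constantly \<open>a\<close> and those that are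
  eventually constantly \<open>b\<close> form two disjoint dense sets. Raising \<open>\<Phi>\<close> to \<open>top\<close> on either of them
  makes it live, and by disjointness the meet of the two modifications is \<open>\<Phi>\<close> again.
\<close>

text \<open>Density makes every supremum over extensions \<open>top\<close>, so
  \<open>domain_of\<close> is the whole lattice and \<open>v = top\<close> is a witness at each word
  of value below \<open>top\<close>.\<close>

lemma live_if_top_dense:
  fixes \<Psi> :: "('a, 'd::complete_lattice) property"
  assumes "\<And>u. \<exists>w'. \<Psi> (u \<frown> w') = top"
  shows "live \<Psi>"
proof -
  have sup_ext: "(SUP w'. \<Psi> (u \<frown> w')) = top" for u
    using assms[of u] by (metis UNIV_I SUP_upper top_unique)
  obtain w where "\<Psi> w = top"
    using assms by blast
  then have "(SUP w. \<Psi> w) = top"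
    by (metis UNIV_I SUP_upper top_unique)
  then have "domain_of \<Psi> = UNIV"
    by (simp add: domain_of_def)
  then show ?thesis
    unfolding live_def live_in_def using sup_ext by (simp add: less_le_not_le) (metis order_refl)
qed

lemma live_raised_if_eventually_const:
  fixes \<Phi> :: "('a, 'd::complete_lattice) property"
  shows "live (\<lambda>w. if \<forall>\<^sub>\<infinity>n. w n = c then top else \<Phi> w)"
proof (rule live_if_top_dense)
  fix u :: "'a list"
  have "(u \<frown> (\<lambda>_. c)) n = c" if "n \<ge> length u" for n
    using that by (simp add: conc_def)
  then have "\<forall>\<^sub>\<infinity>n. (u \<frown> (\<lambda>_. c)) n = c"
    unfolding MOST_nat_le by blast
  then show "\<exists>w'. (if \<forall>\<^sub>\<infinity>n. (u \<frown> w') n = c then top else \<Phi> (u \<frown> w')) = top"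
    by (intro exI[of _ "\<lambda>_. c"]) simp
qed

theorem theorem5p15:
  fixes \<Phi> :: "('a::finite, 'd::complete_lattice) property"
  assumes "CARD('a) \<ge> 2"
    and "(bot :: 'd) \<noteq> top"
  shows "\<exists>\<Psi>\<^sub>1 \<Psi>\<^sub>2 :: ('a, 'd) property.
           live \<Psi>\<^sub>1 \<and> live \<Psi>\<^sub>2 \<and> (\<forall>w. \<Phi> w = inf (\<Psi>\<^sub>1 w) (\<Psi>\<^sub>2 w))"
proof -
  obtain a b :: 'a where "a \<noteq> b"
    using assms(1) card_le_Suc0_iff_eq[of "UNIV :: 'a set"] by fastforce
  define \<Psi> where "\<Psi> c w = (if \<forall>\<^sub>\<infinity>n. w n = c then top else \<Phi> w)" for c :: 'a and w
  have disjoint: "\<not> ((\<forall>\<^sub>\<infinity>n. w n = a) \<and> (\<forall>\<^sub>\<infinity>n. w n = b))" for w :: "'a word"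
    \<comment> \<open>At the larger of the two thresholds, the letter would equal both
      \<open>a\<close> and \<open>b\<close>.\<close>
    unfolding MOST_nat_le using \<open>a \<noteq> b\<close> by (metis max.cobounded1 max.cobounded2)
  have "\<Phi> w = inf (\<Psi> a w) (\<Psi> b w)" for w
    \<comment> \<open>Rewriting with \<open>not_MOST\<close> would hide the negated conditions
      behind infinitely-often statements.\<close>
    unfolding \<Psi>_def using disjoint[of w] by (simp del: not_MOST)
  moreover have "live (\<Psi> c)" for c
    unfolding \<Psi>_def by (rule live_raised_if_eventually_const)
  ultimately show ?thesis
    by blast
qed

end
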